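(* Let $(\mathbb{X},\mathcal{M},\mu)$ be a measure space, let $(\mathbb{Y},d)$ be a metric space with Borel $\sigma$-algebra $\mathcal{B}(\mathbb{Y})$, and let $G\colon(\mathbb{X},\mathcal{M})\to(\mathbb{Y},\mathcal{B}(\mathbb{Y}))$ be measurable. Then: (i) $G$ is strongly measurable (with respect to $\mu$) if and only if it has an essentially separable range; (ii) assuming the continuum hypothesis (CH), $G$ is strongly measurable whenever $\mathcal{M}$ is countably generated; in particular, this applies when $\mathbb{X}$ is a second-countable topological space and $\mathcal{M}$ is its Borel $\sigma$-algebra; (iii) if $\mu$ is finite or $\sigma$-finite and the density $\operatorname{dens}(\mathbb{Y})$ of $\mathbb{Y}$ is strictly smaller than every real-valued measurable cardinal, then $G$ is strongly measurable. In particular, under CH this applies whenever $\operatorname{dens}(\mathbb{Y})\le\mathfrak{c}$ (where $\mathfrak{c}=|\mathbb{R}|$), and it applies to every metric space $\mathbb{Y}$ if no real-valued measurable cardinal exists.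
   Context: Measures are arbitrary (nonnegative, countably additive) unless stated otherwise; the measure space need not be complete. A function $G\colon\mathbb{X}\to\mathbb{Y}$ is simple if it is $(\mathcal{M},\mathcal{B}(\mathbb{Y}))$-measurable and takes only finitely many values. $G$ is strongly measurable (with respect to $\mu$) if it is the $\mu$-almost everywhere pointwise limit of a sequence of simple functions. $G$ has an essentially separable range if there exists a $\mu$-null set $N\in\mathcal{M}$ such that $G(\mathbb{X}\setminus N)$ is contained in a separable subset of $\mathbb{Y}$. A $\sigma$-algebra is countably generated if it is generated by a countable collection of sets. The density $\operatorname{dens}(\mathbb{Y})$ of a metric space is the smallest cardinality of a dense subset. A cardinal $\kappa$ is real-valued measurable if there exist a set $I$ of cardinality $\kappa$ and a countably additive probability measure $\pi$ defined on every subset of $I$ such that (1) $\pi(\{x\})=0$ for every $x\in I$, and (2) whenever fewer than $\kappa$ subsets of $I$ each have $\pi$-measure zero, their union also has $\pi$-measure zero. The base theory is ZFC; CH asserts that there is no cardinal strictly between $\aleph_0$ and $\mathfrak{c}$. *)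

theory Defs
  imports "HOL-Analysis.Analysis" "HOL-Probability.Probability_Measure"
begin

unbundle cardinal_syntax
no_notation Set_Algebras.elt_set_eq (infix "=o" 50)

section \<open>Strong measurability\<close>

definition simple_map :: "'a measure \<Rightarrow> ('a \<Rightarrow> 'b::metric_space) \<Rightarrow> bool" where
  "simple_map M s \<longleftrightarrow> s \<in> measurable M borel \<and> finite (s ` space M)"

lemma simple_map_iff_simple_function: "simple_map M s \<longleftrightarrow> simple_function M s"
  unfolding simple_map_def simple_function_iff_borel_measurable by (rule conj_commute)

definition strongly_measurable :: "'a measure \<Rightarrow> ('a \<Rightarrow> 'b::metric_space) \<Rightarrow> bool" where
  "strongly_measurable M G \<longleftrightarrow>
     (\<exists>s :: nat \<Rightarrow> 'a \<Rightarrow> 'b. (\<forall>n. simple_map M (s n)) \<and> (AE x in M. (\<lambda>n. s n x) \<longlonglongrightarrow> G x))"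

definition essentially_separable_range :: "'a measure \<Rightarrow> ('a \<Rightarrow> 'b::metric_space) \<Rightarrow> bool" where
  "essentially_separable_range M G \<longleftrightarrow>
     (\<exists>N \<in> null_sets M. \<exists>S. separable_space (top_of_set S) \<and> G ` (space M - N) \<subseteq> S)"

definition countably_generated :: "'a measure \<Rightarrow> bool" where
  "countably_generated M \<longleftrightarrow>
     (\<exists>E. countable E \<and> E \<subseteq> Pow (space M) \<and> sets M = sigma_sets (space M) E)"


section \<open>Cardinals\<close>

text \<open>Cardinals are represented by minimal well-orders, determined up to \<open>=o\<close>.\<close>

text \<open>Every cardinal below the continuum is realised by a well-order on a set of reals, so
  it suffices to let \<open>\<kappa>\<close> range over cardinal orders on the type of reals.\<close>

definition continuum_hypothesis :: bool where
  "continuum_hypothesis \<longleftrightarrow>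
     \<not> (\<exists>\<kappa> :: real rel. Card_order \<kappa> \<and> natLeq <o \<kappa> \<and> \<kappa> <o |UNIV :: real set| )"

text \<open>The density of the metric space given by the type \<open>'b\<close>.\<close>

definition dens :: "'b::metric_space rel" where
  "dens = (SOME \<kappa>. \<exists>D :: 'b set. closure D = UNIV \<and> \<kappa> = |D| \<and>
                     (\<forall>D' :: 'b set. closure D' = UNIV \<longrightarrow> |D| \<le>o |D'| ))"

lemma dens_attained:
  "\<exists>D :: 'b::metric_space set. closure D = UNIV \<and> dens = |D| \<and>
                     (\<forall>D' :: 'b set. closure D' = UNIV \<longrightarrow> |D| \<le>o |D'| )"
proof -
  let ?R = "{|D| | D :: 'b set. closure D = UNIV}"
  have "|UNIV :: 'b set| \<in> ?R" by (metis (mono_tags) closure_UNIV mem_Collect_eq)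
  then have "?R \<noteq> {}" by blast
  moreover have "\<forall>r \<in> ?R. Card_order r" by (auto simp: card_of_Card_order)
  ultimately have "\<exists>r \<in> ?R. \<forall>r' \<in> ?R. r \<le>o r'" by (rule exists_minim_Card_order)
  then have "\<exists>\<kappa>. \<exists>D :: 'b set. closure D = UNIV \<and> \<kappa> = |D| \<and>
                     (\<forall>D' :: 'b set. closure D' = UNIV \<longrightarrow> |D| \<le>o |D'| )"
    by blast
  then show ?thesis unfolding dens_def by (rule someI_ex)
qed

definition real_valued_measurable :: "'k rel \<Rightarrow> bool" where
  "real_valued_measurable \<kappa> \<longleftrightarrow> Card_order \<kappa> \<and>
     (\<exists>(I :: 'k set) \<pi>. |I| =o \<kappa> \<and> prob_space \<pi> \<and> sets \<pi> = Pow I \<and>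
        (\<forall>x\<in>I. emeasure \<pi> {x} = 0) \<and>
        (\<forall>F. F \<subseteq> Pow I \<and> |F| <o \<kappa> \<and> (\<forall>A\<in>F. emeasure \<pi> A = 0) \<longrightarrow> emeasure \<pi> (\<Union>F) = 0))"

text \<open>HOL cannot quantify over the cardinals of all types inside a formula. In the next
  definition \<open>\<kappa>\<close> ranges over the cardinals realised on subsets of \<open>'b\<close>, that is, those at most
  \<open>|UNIV :: 'b set|\<close>. Larger cardinals exceed the density anyway, so nothing is lost:
  lemma \<open>dens_below_measurable_any_type\<close> gives the inequality for cardinals on any type.\<close>

definition dens_below_measurable :: "'b::metric_space itself \<Rightarrow> bool" where
  "dens_below_measurable _ \<longleftrightarrow>
     (\<forall>\<kappa> :: 'b rel. real_valued_measurable \<kappa> \<longrightarrow> (dens :: 'b rel) <o \<kappa>)"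

lemma real_valued_measurable_transfer:
  fixes \<kappa> :: "'k rel"
  assumes "real_valued_measurable \<kappa>" and le: "\<kappa> \<le>o |UNIV :: 'b set|"
  shows "\<exists>\<kappa>' :: 'b rel. real_valued_measurable \<kappa>' \<and> \<kappa>' =o \<kappa>"
proof -
  obtain I :: "'k set" and \<pi> where I: "|I| =o \<kappa>" and ps: "prob_space \<pi>"
    and sets: "sets \<pi> = Pow I" and pt: "\<forall>x\<in>I. emeasure \<pi> {x} = 0"
    and add: "\<forall>F. F \<subseteq> Pow I \<and> |F| <o \<kappa> \<and> (\<forall>A\<in>F. emeasure \<pi> A = 0)
                \<longrightarrow> emeasure \<pi> (\<Union>F) = 0"
    using assms(1) unfolding real_valued_measurable_def by (elim conjE exE) (rule that)
  have sp: "space \<pi> = I"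
    using sets.top[of \<pi>] sets.sets_into_space[of I \<pi>] sets by auto
  have "|I| \<le>o |UNIV :: 'b set|" using I le by (rule ordIso_ordLeq_trans)
  then obtain f :: "'k \<Rightarrow> 'b" where inj: "inj_on f I"
    by (auto simp: card_of_ordLeq[symmetric])
  let ?J = "f ` I"
  have J: "|?J| =o |I|"
    by (rule ordIso_symmetric, rule card_of_ordIsoI, rule inj_on_imp_bij_betw[OF inj])
  have JK: "|?J| =o \<kappa>" using J I by (rule ordIso_transitive)
  have meas: "f \<in> measurable \<pi> (count_space ?J)"
    by (rule measurableI) (auto simp: sp sets)
  let ?p = "distr \<pi> (count_space ?J) f"
  have em: "emeasure ?p A = emeasure \<pi> (f -` A \<inter> I)" if "A \<subseteq> ?J" for A
    using that meas by (subst emeasure_distr) (auto simp: sp)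
  have "real_valued_measurable |?J|"
    unfolding real_valued_measurable_def
  proof (intro conjI exI[of _ ?J] exI[of _ ?p] ballI allI impI)
    show "prob_space ?p" by (rule prob_space.prob_space_distr[OF ps meas])
  next
    fix y assume "y \<in> ?J"
    then obtain x where x: "x \<in> I" "y = f x" by blast
    then have "f -` {y} \<inter> I = {x}" using inj by (auto simp: inj_on_def)
    then show "emeasure ?p {y} = 0" using x pt em[of "{y}"] by auto
  next
    fix F assume F: "F \<subseteq> Pow ?J \<and> |F| <o |?J| \<and> (\<forall>A\<in>F. emeasure ?p A = 0)"
    let ?F = "(\<lambda>A. f -` A \<inter> I) ` F"
    have "|?F| \<le>o |F|" by (rule card_of_image)
    also have "|F| <o |?J|" using F by blast
    also have "|?J| =o \<kappa>" by (rule JK)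
    finally have c: "|?F| <o \<kappa>" .
    have "emeasure \<pi> (\<Union>?F) = 0"
    proof (rule add[rule_format], intro conjI c ballI)
      show "emeasure \<pi> B = 0" if B: "B \<in> ?F" for B
      proof -
        obtain A where A: "A \<in> F" "B = f -` A \<inter> I" using B by (rule imageE)
        then have "A \<subseteq> ?J" using F by blast
        then show ?thesis using em[of A] A F by simp
      qed
    qed auto
    moreover have "\<Union>?F = f -` (\<Union>F) \<inter> I" by auto
    moreover have "\<Union>F \<subseteq> ?J" using F by blast
    ultimately show "emeasure ?p (\<Union>F) = 0" using em[of "\<Union>F"] by simp
  qed (auto simp: card_of_Card_order card_of_refl)
  then show ?thesis using JK by blast
qed

lemma dens_below_measurable_any_type:
  fixes \<kappa> :: "'k rel"
  assumes "dens_below_measurable TYPE('b::metric_space)" and "real_valued_measurable \<kappa>"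
  shows "(dens :: 'b rel) <o \<kappa>"
proof (rule ccontr)
  obtain D :: "'b set" where D: "dens = |D|" using dens_attained by blast
  have "Card_order \<kappa>" using assms(2) by (simp add: real_valued_measurable_def)
  moreover assume "\<not> (dens :: 'b rel) <o \<kappa>"
  ultimately have le: "\<kappa> \<le>o (dens :: 'b rel)"
    unfolding D by (meson card_of_Well_order card_order_on_well_order_on not_ordLess_iff_ordLeq)
  moreover have "(dens :: 'b rel) \<le>o |UNIV :: 'b set|" unfolding D by (rule card_of_mono1) simp
  ultimately have "\<kappa> \<le>o |UNIV :: 'b set|" by (rule ordLeq_transitive)
  from real_valued_measurable_transfer[OF assms(2) this]
  obtain \<kappa>' :: "'b rel" where "real_valued_measurable \<kappa>'" "\<kappa>' =o \<kappa>" by blast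
  then have "(dens :: 'b rel) <o \<kappa>"
    using assms(1) unfolding dens_below_measurable_def by (meson ordLess_ordIso_trans)
  then show False using le not_ordLess_ordLeq by blast
qed

end

theory Submission
  imports Defs "HOL-Library.Countable_Set_Type"
begin

text \<open>
  Off a null set, a strongly measurable map takes its values in the closure of the countable set
  of values of the approximating simple maps. Conversely, if \<open>G\<close> almost everywhere takes its
  values in the closure of \<open>{c 0, c 1, \<dots>}\<close>, sending \<open>x\<close> to a nearest point to \<open>G x\<close> among
  \<open>c 0, \<dots>, c n\<close> (the first one in case of ties) defines simple maps that converge
  to \<open>G\<close> almost everywhere. So strong measurability is essential separability of the range, and the latter holds as soon as for each
  \<open>e > 0\<close> countably many balls of radius \<open>e\<close> contain almost all values.

  For a countably generated sigma-algebra, let \<open>A\<close> be an \<open>e\<close>-separated set of values of \<open>G\<close>. Every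
  subset of \<open>A\<close> is closed, so taking preimages embeds \<open>Pow A\<close> into the sigma-algebra, which has
  at most continuum many members (\<open>card_sets_countably_generated\<close>). Hence \<open>A\<close> has fewer elements
  than the continuum and is countable under CH. A maximal such \<open>A\<close> is an \<open>e\<close>-net of the range.

  For finite measures and radius \<open>r\<close>, well-order a dense set \<open>D\<close> of least cardinality and put
  \<open>E s y = cball y s - (\<Union>z<y. ball z r)\<close> for \<open>s < r\<close>, where \<open>z\<close> ranges
  over \<open>D\<close>. For distinct \<open>y\<close> in \<open>D\<close> these closed sets have distance at least \<open>r - s\<close> from each other, so every union of them is closed, and the
  measure of the preimage of \<open>\<Union>y\<in>J. E s y\<close> is a finite measure in \<open>J\<close>, defined on all of
  \<open>Pow D\<close>. If no real-valued measurable cardinal is at most \<open>|D|\<close>, this measure lives on countably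
  many points (\<open>countable_support_if_no_real_valued_measurable\<close>). As \<open>s\<close> increases to \<open>r\<close> along a
  sequence, the sets \<open>E s y\<close> exhaust the space, so countably many balls of radius \<open>r\<close> contain
  almost all values. A sigma-finite measure has the same null sets as some finite measure.

  Finally, under CH a matrix of Ulam shows that no cardinal up to the continuum is real-valued
  measurable (\<open>not_real_valued_measurable_if_le_continuum\<close>).
\<close>

section \<open>Strong measurability and essentially separable range\<close>

lemma essentially_separable_range_iff:
  fixes G :: "'a \<Rightarrow> 'b::metric_space"
  shows "essentially_separable_range M G \<longleftrightarrow>
    (\<exists>N \<in> null_sets M. \<exists>C. countable C \<and> G ` (space M - N) \<subseteq> closure C)"
proof
  assume "essentially_separable_range M G"
  then obtain N S where N: "N \<in> null_sets M" and S: "separable_space (top_of_set S)"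
    and G: "G ` (space M - N) \<subseteq> S"
    unfolding essentially_separable_range_def by blast
  from S obtain C where "countable C" "C \<subseteq> S" "top_of_set S closure_of C = S"
    unfolding separable_space_def by auto
  then have "S \<subseteq> closure C" by (auto simp: closure_of_subtopology Int_absorb1)
  with N G \<open>countable C\<close> show "\<exists>N \<in> null_sets M. \<exists>C. countable C \<and> G ` (space M - N) \<subseteq> closure C"
    by blast
next
  assume "\<exists>N \<in> null_sets M. \<exists>C. countable C \<and> G ` (space M - N) \<subseteq> closure C"
  then obtain N C where N: "N \<in> null_sets M" and C: "countable C"
    and G: "G ` (space M - N) \<subseteq> closure C" by blast
  have "separable_space (top_of_set (closure C))"
    unfolding separable_space_def using C closure_subset
    by (intro exI[of _ C]) (auto simp: closure_of_subtopology Int_absorb1)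
  with N G show "essentially_separable_range M G"
    unfolding essentially_separable_range_def by blast
qed

lemma essentially_separable_range_if_countable_nets:
  fixes G :: "'a \<Rightarrow> 'b::metric_space"
  assumes "\<And>e. e > 0 \<Longrightarrow>
    \<exists>N \<in> null_sets M. \<exists>C. countable C \<and> (\<forall>x \<in> space M - N. \<exists>c \<in> C. dist c (G x) < e)"
  shows "essentially_separable_range M G"
proof -
  have "\<exists>N C. N \<in> null_sets M \<and> countable C \<and>
    (\<forall>x \<in> space M - N. \<exists>c \<in> C. dist c (G x) < inverse (real (Suc n)))" for n
  proof -
    have "0 < inverse (real (Suc n))" by simp
    from assms[OF this] show ?thesis by blast
  qed
  then obtain N C where N: "\<And>n::nat. N n \<in> null_sets M" and C: "\<And>n. countable (C n)"
    and near: "\<And>n x. x \<in> space M - N n \<Longrightarrow> \<exists>c \<in> C n. dist c (G x) < inverse (real (Suc n))"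
    by metis
  show ?thesis unfolding essentially_separable_range_iff
  proof (intro bexI[of _ "\<Union>n. N n"] exI[of _ "\<Union>n. C n"] conjI subsetI)
    fix y assume "y \<in> G ` (space M - (\<Union>n. N n))"
    then obtain x where x: "y = G x" "x \<in> space M" "\<And>n. x \<notin> N n" by auto
    show "y \<in> closure (\<Union>n. C n)"
      unfolding closure_approachable
    proof (intro allI impI)
      fix e :: real assume "e > 0"
      then obtain n where n: "inverse (real (Suc n)) < e" using reals_Archimedean by blast
      from near[of x n] x obtain c where "c \<in> C n" "dist c y < inverse (real (Suc n))" by blast
      with n show "\<exists>c\<in>\<Union>n. C n. dist c y < e" by (meson UN_I UNIV_I order_less_trans)
    qed
  qed (use N C in auto)
qed

lemma strongly_measurable_imp_essentially_separable_range:
  fixes G :: "'a \<Rightarrow> 'b::metric_space"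
  assumes "strongly_measurable M G"
  shows "essentially_separable_range M G"
proof -
  from assms obtain s where s: "\<And>n::nat. simple_map M (s n)"
    and lim: "AE x in M. (\<lambda>n. s n x) \<longlonglongrightarrow> G x"
    unfolding strongly_measurable_def by blast
  from lim obtain N where N: "N \<in> null_sets M"
    and lim: "\<And>x. x \<in> space M - N \<Longrightarrow> (\<lambda>n. s n x) \<longlonglongrightarrow> G x"
    by (auto elim!: AE_E3)
  let ?C = "\<Union>n. s n ` space M"
  have "countable ?C" using s by (auto simp: simple_map_def intro: countable_finite)
  moreover have "G ` (space M - N) \<subseteq> closure ?C"
    using lim by (fastforce simp: closure_sequential)
  ultimately show ?thesis unfolding essentially_separable_range_iff using N by blast
qed

lemma essentially_separable_range_imp_strongly_measurable:
  fixes G :: "'a \<Rightarrow> 'b::metric_space"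
  assumes G [measurable]: "G \<in> measurable M borel" and "essentially_separable_range M G"
  shows "strongly_measurable M G"
proof -
  from assms(2) obtain N C0 where N: "N \<in> null_sets M" and "countable C0"
    and GC0: "G ` (space M - N) \<subseteq> closure C0"
    unfolding essentially_separable_range_iff by blast
  \<comment> \<open>An arbitrary extra point makes the set nonempty, so that it can be enumerated.\<close>
  define C where "C = insert undefined C0"
  have C: "countable C" "C \<noteq> {}" and GC: "G ` (space M - N) \<subseteq> closure C"
    using \<open>countable C0\<close> GC0 closure_mono[of C0 C] by (auto simp: C_def)
  define c where "c = from_nat_into C"
  have c: "range c = C" unfolding c_def using C by (rule range_from_nat_into[rotated])
  \<comment> \<open>\<open>near n x k\<close>: among \<open>c 0, \<dots>, c n\<close>, the point \<open>c k\<close> is a nearest one to \<open>G x\<close>.\<close>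
  define near where "near n x k \<longleftrightarrow> k \<le> n \<and> (\<forall>j\<le>n. dist (G x) (c k) \<le> dist (G x) (c j))" for n x k
  define s where "s n x = c (LEAST k. near n x k)" for n x
  have near: "near n x (LEAST k. near n x k)" for n x
  proof (rule LeastI_ex)
    have "finite {..n}" "{..n} \<noteq> {}" by auto
    then obtain k where "is_arg_min (\<lambda>j. dist (G x) (c j)) (\<lambda>j. j \<in> {..n}) k"
      using ex_is_arg_min_if_finite by blast
    then have "near n x k" unfolding near_def is_arg_min_linorder by simp
    then show "\<exists>k. near n x k" ..
  qed
  have [measurable]: "(\<lambda>x. dist (G x) y) \<in> borel_measurable M" for y
    by (rule measurable_compose[OF G]) (intro borel_measurable_continuous_onI continuous_intros)
  have [measurable]: "Measurable.pred M (\<lambda>x. near n x k)" for n k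
    unfolding near_def by measurable
  have "s n \<in> measurable M borel" for n
    unfolding s_def by (rule measurable_compose[of _ M "count_space UNIV"]) measurable
  moreover have "finite (s n ` space M)" for n
    by (rule finite_subset[of _ "c ` {..n}"]) (use near in \<open>auto simp: s_def near_def\<close>)
  moreover have "AE x in M. (\<lambda>n. s n x) \<longlonglongrightarrow> G x"
  proof (rule AE_I'[OF N], safe, rule ccontr)
    fix x assume x: "x \<in> space M" "x \<notin> N" and "\<not> (\<lambda>n. s n x) \<longlonglongrightarrow> G x"
    have "(\<lambda>n. s n x) \<longlonglongrightarrow> G x"
    proof (rule metric_LIMSEQ_I)
      fix e :: real assume "e > 0"
      have "G x \<in> closure C" using GC x by blast
      with \<open>e > 0\<close> obtain y where "y \<in> C" "dist y (G x) < e" unfolding closure_approachable by blast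
      then obtain j where j: "dist (c j) (G x) < e" using c by auto
      have "dist (s n x) (G x) < e" if "n \<ge> j" for n
      proof -
        have "dist (G x) (s n x) \<le> dist (G x) (c j)"
          using near[of n x] that unfolding s_def near_def by blast
        with j show ?thesis by (simp add: dist_commute)
      qed
      then show "\<exists>no. \<forall>n\<ge>no. dist (s n x) (G x) < e" by blast
    qed
    then show False using \<open>\<not> (\<lambda>n. s n x) \<longlonglongrightarrow> G x\<close> by blast
  qed
  ultimately show ?thesis unfolding strongly_measurable_def simple_map_def by blast
qed

section \<open>Countably generated sigma-algebras under the continuum hypothesis\<close>

lemma countable_if_card_less_continuum:
  fixes A :: "'c set"
  assumes "continuum_hypothesis" and less: "|A| <o |UNIV :: real set|"
  shows "countable A"
proof (rule ccontr)
  assume "\<not> countable A"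
  then have "natLeq <o |A|"
    by (simp add: countable_card_le_natLeq not_ordLeq_iff_ordLess card_of_Well_order natLeq_Well_order)
  obtain f :: "'c \<Rightarrow> real" where "inj_on f A"
    using ordLess_imp_ordLeq[OF less] by (auto simp: card_of_ordLeq[symmetric])
  then have iso: "|A| =o |f ` A|" by (intro card_of_ordIsoI[OF inj_on_imp_bij_betw])
  have "natLeq <o |f ` A|" using \<open>natLeq <o |A|\<close> iso by (rule ordLess_ordIso_trans)
  moreover have "|f ` A| <o |UNIV :: real set|"
    using ordIso_symmetric[OF iso] less by (rule ordIso_ordLess_trans)
  ultimately show False
    using assms(1) card_of_Card_order unfolding continuum_hypothesis_def by blast
qed

text \<open>
  Members of a generated sigma-algebra are described by well-founded trees, each recording one way
  to build the set from the generators. This bounds the cardinality of the sigma-algebra without a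
  transfinite recursion over the Borel hierarchy.
\<close>

datatype sigma_code = Basic_Code nat | Compl_Code sigma_code | Union_Code "nat \<Rightarrow> sigma_code"

text \<open>
  The set described by a code, for the generators \<open>e 0, e 1, \<dots>\<close> on the space \<open>\<Omega>\<close>.
\<close>

primrec decode :: "'a set \<Rightarrow> (nat \<Rightarrow> 'a set) \<Rightarrow> sigma_code \<Rightarrow> 'a set" where
  "decode \<Omega> e (Basic_Code n) = e n"
| "decode \<Omega> e (Compl_Code c) = \<Omega> - decode \<Omega> e c"
| "decode \<Omega> e (Union_Code f) = (\<Union>n. decode \<Omega> e (f n))"

text \<open>
  The node labels of the tree of a code: a finite sequence \<open>p\<close> of child indices leads to a node,
  labelled \<open>0\<close> for a complement, \<open>1\<close> for a union and \<open>n + 2\<close> for the generator \<open>n\<close>. Below a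
  generator, and at every index below a complement, labels are just repeated, which keeps the
  function total.
\<close>

primrec tree_label :: "sigma_code \<Rightarrow> nat list \<Rightarrow> nat" where
  "tree_label (Basic_Code n) = (\<lambda>p. n + 2)"
| "tree_label (Compl_Code c) = (\<lambda>p. case p of [] \<Rightarrow> 0 | _ # q \<Rightarrow> tree_label c q)"
| "tree_label (Union_Code f) = (\<lambda>p. case p of [] \<Rightarrow> 1 | n # q \<Rightarrow> tree_label (f n) q)"

lemma tree_label_inject: "tree_label c = tree_label d \<Longrightarrow> c = d"
proof (induction c arbitrary: d)
  case (Basic_Code n)
  then show ?case by (cases d) (auto dest: fun_cong[of _ _ "[]"])
next
  case (Compl_Code c)
  from Compl_Code.prems obtain d' where d: "d = Compl_Code d'"
    by (cases d) (auto dest: fun_cong[of _ _ "[]"])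
  have "tree_label c q = tree_label d' q" for q
    using fun_cong[OF Compl_Code.prems, of "0 # q"] by (simp add: d)
  then show ?case using Compl_Code.IH d by blast
next
  case (Union_Code f)
  from Union_Code.prems obtain g where d: "d = Union_Code g"
    by (cases d) (auto dest: fun_cong[of _ _ "[]"])
  have "tree_label (f n) q = tree_label (g n) q" for n q
    using fun_cong[OF Union_Code.prems, of "n # q"] by (simp add: d)
  then have "f n = g n" for n using Union_Code.IH by blast
  then show ?case using d by blast
qed

text \<open>
  A code is determined by the graph of its labelling, that is, by a set of natural numbers.
\<close>

lemma card_sigma_code: "|UNIV :: sigma_code set| \<le>o |UNIV :: real set|"
proof -
  obtain g :: "nat set \<Rightarrow> real" where "inj g"
    using nat_sets_eqpoll_reals unfolding eqpoll_def bij_betw_def by blast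
  moreover have "inj (\<lambda>c. range (\<lambda>p. to_nat (p, tree_label c p)))"
  proof (rule injI, rule tree_label_inject, rule ext)
    fix c d p
    assume "range (\<lambda>p. to_nat (p, tree_label c p)) = range (\<lambda>p. to_nat (p, tree_label d p))"
    then have "to_nat (p, tree_label c p) \<in> range (\<lambda>p. to_nat (p, tree_label d p))" by blast
    then show "tree_label c p = tree_label d p" by auto
  qed
  ultimately have "inj (g \<circ> (\<lambda>c. range (\<lambda>p. to_nat (p, tree_label c p))))" by (rule inj_compose)
  then show ?thesis unfolding card_of_ordLeq[symmetric] by blast
qed

lemma card_sets_countably_generated:
  assumes "countably_generated M"
  shows "|sets M| \<le>o |UNIV :: real set|"
proof -
  from assms obtain E where E: "countable E" "sets M = sigma_sets (space M) E"
    unfolding countably_generated_def by blast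
  \<comment> \<open>Adding the empty set makes the family of generators nonempty and provides a code for it.\<close>
  define e where "e = from_nat_into (insert {} E)"
  have e: "range e = insert {} E"
    unfolding e_def using E(1) by (intro range_from_nat_into) auto
  have "A \<in> range (decode (space M) e)" if "A \<in> sigma_sets (space M) E" for A
    using that
  proof induction
    case (Basic a)
    then obtain n where "a = e n" using e by blast
    then show ?case by (intro image_eqI[of _ _ "Basic_Code n"]) auto
  next
    case Empty
    obtain n where "{} = e n" using e by blast
    then show ?case by (intro image_eqI[of _ _ "Basic_Code n"]) auto
  next
    case (Compl a)
    then obtain c where "a = decode (space M) e c" by blast
    then show ?case by (intro image_eqI[of _ _ "Compl_Code c"]) auto
  next
    case (Union a)
    then have "\<forall>n. \<exists>c. a n = decode (space M) e c" by blast
    then obtain f where "\<And>n. a n = decode (space M) e (f n)" by metis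
    then show ?case by (intro image_eqI[of _ _ "Union_Code f"]) auto
  qed
  then have "sets M \<subseteq> range (decode (space M) e)" using E(2) by blast
  then have "|sets M| \<le>o |range (decode (space M) e)|" by (rule card_of_mono1)
  also have "|range (decode (space M) e)| \<le>o |UNIV :: sigma_code set|" by (rule card_of_image)
  also note card_sigma_code
  finally show ?thesis .
qed

lemma countably_generated_second_countable:
  assumes top: "topspace T = space M" and "second_countable T"
    and sets: "sets M = sigma_sets (topspace T) {U. openin T U}"
  shows "countably_generated M"
proof -
  from assms(2) obtain B where B: "countable B" "\<forall>V\<in>B. openin T V"
    and base: "\<forall>U x. openin T U \<and> x \<in> U \<longrightarrow> (\<exists>V\<in>B. x \<in> V \<and> V \<subseteq> U)"
    unfolding second_countable_def by (elim exE conjE)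
  have "U \<in> sigma_sets (space M) B" if "openin T U" for U
  proof -
    have "U = \<Union>{V \<in> B. V \<subseteq> U}" using base that by blast
    moreover have "\<Union>{V \<in> B. V \<subseteq> U} \<in> sigma_sets (space M) B"
      using B(1) by (intro sigma_sets_UNION) auto
    ultimately show ?thesis by simp
  qed
  then have "sets M = sigma_sets (space M) B"
    unfolding sets top by (intro sigma_sets_eqI) (use B(2) in auto)
  moreover have "B \<subseteq> Pow (space M)" using B(2) openin_subset top by blast
  ultimately show ?thesis unfolding countably_generated_def using B(1) by blast
qed

lemma maximal_separated_subset:
  fixes S :: "'b::metric_space set"
  assumes "e > 0"
  obtains A where "A \<subseteq> S" "\<And>x y. x \<in> A \<Longrightarrow> y \<in> A \<Longrightarrow> dist y x < e \<Longrightarrow> y = x"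
    "\<And>x. x \<in> S \<Longrightarrow> \<exists>a\<in>A. dist a x < e"
proof -
  define \<A> where "\<A> = {A. A \<subseteq> S \<and> (\<forall>x\<in>A. \<forall>y\<in>A. dist y x < e \<longrightarrow> y = x)}"
  have "\<exists>A\<in>\<A>. \<forall>X\<in>\<A>. A \<subseteq> X \<longrightarrow> X = A"
  proof (rule subset_Zorn')
    fix C assume C: "subset.chain \<A> C"
    then have sub: "C \<subseteq> \<A>" and lin: "\<And>X Y. X \<in> C \<Longrightarrow> Y \<in> C \<Longrightarrow> X \<subseteq> Y \<or> Y \<subseteq> X"
      by (auto simp: subset_chain_def)
    have "y = x" if "x \<in> \<Union>C" "y \<in> \<Union>C" "dist y x < e" for x y
    proof -
      from that obtain X Y where "X \<in> C" "x \<in> X" "Y \<in> C" "y \<in> Y" by blast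
      with lin obtain Z where "Z \<in> C" "x \<in> Z" "y \<in> Z" by blast
      then show ?thesis using sub that(3) unfolding \<A>_def by blast
    qed
    then show "\<Union>C \<in> \<A>" using sub unfolding \<A>_def by blast
  qed
  then obtain A where A: "A \<in> \<A>" and max: "\<And>X. X \<in> \<A> \<Longrightarrow> A \<subseteq> X \<Longrightarrow> X = A" by blast
  have "\<exists>a\<in>A. dist a x < e" if "x \<in> S" for x
  proof (rule ccontr)
    assume far: "\<not> (\<exists>a\<in>A. dist a x < e)"
    then have "insert x A \<in> \<A>"
      using A that unfolding \<A>_def by (auto simp: dist_commute)
    then have "insert x A = A" using max by blast
    then show False using far \<open>e > 0\<close> by (metis dist_self insertI1)
  qed
  moreover have "y = x" if "x \<in> A" "y \<in> A" "dist y x < e" for x y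
    using A that unfolding \<A>_def by blast
  moreover have "A \<subseteq> S" using A unfolding \<A>_def by blast
  ultimately show thesis by (intro that[of A])
qed

text \<open>
  Each subset \<open>J\<close> of \<open>A\<close> is closed, being separated, and is recovered from its preimage because
  \<open>A\<close> lies in the range of \<open>G\<close>. Thus \<open>2 ^ |A|\<close> is at most the cardinality of the sigma-algebra.
\<close>

lemma separated_subset_range_countable:
  fixes G :: "'a \<Rightarrow> 'b::metric_space"
  assumes G: "G \<in> measurable M borel" and CH: "continuum_hypothesis"
    and cg: "countably_generated M" and "e > 0" and A: "A \<subseteq> G ` space M"
    and sep: "\<And>x y. x \<in> A \<Longrightarrow> y \<in> A \<Longrightarrow> dist y x < e \<Longrightarrow> y = x"
  shows "countable A"
proof (rule countable_if_card_less_continuum[OF CH])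
  have "G -` J \<inter> space M \<in> sets M" if "J \<in> Pow A" for J
  proof -
    have "closed J" by (rule discrete_imp_closed[OF \<open>e > 0\<close>]) (use sep that in blast)
    then show ?thesis by (intro measurable_sets[OF G]) auto
  qed
  moreover have "inj_on (\<lambda>J. G -` J \<inter> space M) (Pow A)"
  proof (rule inj_onI)
    fix J K assume JK: "J \<in> Pow A" "K \<in> Pow A" "G -` J \<inter> space M = G -` K \<inter> space M"
    have "L = G ` (G -` L \<inter> space M)" if "L \<in> Pow A" for L using A that by blast
    with JK show "J = K" by metis
  qed
  ultimately have "|Pow A| \<le>o |sets M|" unfolding card_of_ordLeq[symmetric] by blast
  with card_of_Pow have "|A| <o |sets M|" by (rule ordLess_ordLeq_trans)
  then show "|A| <o |UNIV :: real set|"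
    using card_sets_countably_generated[OF cg] by (rule ordLess_ordLeq_trans)
qed

lemma countably_generated_imp_essentially_separable_range:
  fixes G :: "'a \<Rightarrow> 'b::metric_space"
  assumes "G \<in> measurable M borel" "continuum_hypothesis" "countably_generated M"
  shows "essentially_separable_range M G"
proof (rule essentially_separable_range_if_countable_nets)
  fix e :: real assume "e > 0"
  then obtain A where A: "A \<subseteq> G ` space M" "\<And>x y. x \<in> A \<Longrightarrow> y \<in> A \<Longrightarrow> dist y x < e \<Longrightarrow> y = x"
    "\<And>x. x \<in> G ` space M \<Longrightarrow> \<exists>a\<in>A. dist a x < e"
    by (rule maximal_separated_subset[where S = "G ` space M"]) blast
  have "countable A"
    using separated_subset_range_countable[OF assms \<open>e > 0\<close> A(1,2)] by blast
  with A(3) show "\<exists>N \<in> null_sets M. \<exists>C. countable C \<and> (\<forall>x \<in> space M - N. \<exists>c \<in> C. dist c (G x) < e)"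
    by (intro bexI[of _ "{}"] exI[of _ A]) auto
qed

section \<open>Finite measures on all subsets of a set\<close>

text \<open>
  The cardinal is the least cardinality of a family \<open>F\<close> of null sets whose union is not null. Its
  measure is the normalised restriction of \<open>\<pi>\<close> to \<open>\<Union>F\<close>, pushed forward to \<open>F\<close> by a map that sends each
  point to a member of \<open>F\<close> containing it. Minimality of \<open>|F|\<close> yields the additivity of null sets.
\<close>

lemma real_valued_measurable_if_diffuse:
  fixes I :: "'i set"
  assumes "finite_measure \<pi>" and sets: "sets \<pi> = Pow I"
    and diffuse: "\<And>x. x \<in> I \<Longrightarrow> emeasure \<pi> {x} = 0" and pos: "emeasure \<pi> I \<noteq> 0"
  shows "\<exists>\<kappa> :: 'i set rel. real_valued_measurable \<kappa> \<and> \<kappa> \<le>o |I|"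
proof -
  interpret finite_measure \<pi> by fact
  define R where "R = {|F| | F. F \<subseteq> Pow I \<and> (\<forall>A\<in>F. emeasure \<pi> A = 0) \<and> emeasure \<pi> (\<Union>F) \<noteq> 0}"
  let ?S = "(\<lambda>x. {x}) ` I"
  have "\<Union>?S = I" by blast
  then have S: "|?S| \<in> R" unfolding R_def using diffuse pos by fastforce
  have "\<forall>r\<in>R. Card_order r" unfolding R_def using card_of_Card_order by blast
  then obtain \<kappa> where "\<kappa> \<in> R" and min: "\<And>r. r \<in> R \<Longrightarrow> \<kappa> \<le>o r"
    using exists_minim_Card_order[of R] S by blast
  then obtain F where \<kappa>: "\<kappa> = |F|" and F: "F \<subseteq> Pow I"
    and null: "\<And>A. A \<in> F \<Longrightarrow> emeasure \<pi> A = 0" and Fpos: "emeasure \<pi> (\<Union>F) \<noteq> 0"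
    unfolding R_def by blast
  have "F \<noteq> {}" using Fpos by auto
  define h where "h x = (SOME A. A \<in> F \<and> (x \<in> \<Union>F \<longrightarrow> x \<in> A))" for x
  have h: "h x \<in> F \<and> (x \<in> \<Union>F \<longrightarrow> x \<in> h x)" for x
    unfolding h_def by (rule someI_ex) (use \<open>F \<noteq> {}\<close> in blast)
  have sp: "space \<pi> = I" using sets.top[of \<pi>] sets.sets_into_space[of I \<pi>] sets by auto
  let ?U = "uniform_measure \<pi> (\<Union>F)"
  let ?p = "distr ?U (count_space F) h"
  have U: "\<Union>F \<in> sets \<pi>" using F by (auto simp: sets)
  have meas: "h \<in> measurable ?U (count_space F)"
    by (rule measurableI) (use h in \<open>auto simp: sp sets\<close>)
  have em: "emeasure ?p B = 0 \<longleftrightarrow> emeasure \<pi> (\<Union>F \<inter> h -` B) = 0" if "B \<subseteq> F" for B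
  proof -
    have "emeasure ?p B = emeasure ?U (h -` B \<inter> I)"
      using meas that by (subst emeasure_distr) (auto simp: sp)
    also have "\<dots> = emeasure \<pi> (\<Union>F \<inter> (h -` B \<inter> I)) / emeasure \<pi> (\<Union>F)"
      using U by (intro emeasure_uniform_measure) (auto simp: sets)
    also have "\<Union>F \<inter> (h -` B \<inter> I) = \<Union>F \<inter> h -` B" using F by blast
    finally show ?thesis using emeasure_finite[of "\<Union>F"] Fpos by (simp add: divide_ennreal_def)
  qed
  have "real_valued_measurable |F|"
    unfolding real_valued_measurable_def
  proof (intro conjI exI[of _ F] exI[of _ ?p] ballI allI impI)
    show "prob_space ?p"
      using meas Fpos emeasure_finite
      by (intro prob_space.prob_space_distr prob_space_uniform_measure) auto
  next
    fix A assume "A \<in> F"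
    have "emeasure \<pi> (\<Union>F \<inter> h -` {A}) \<le> emeasure \<pi> A"
      using h \<open>A \<in> F\<close> F by (intro emeasure_mono) (auto simp: sets)
    then show "emeasure ?p {A} = 0" using em[of "{A}"] null \<open>A \<in> F\<close> by simp
  next
    fix \<B> assume \<B>: "\<B> \<subseteq> Pow F \<and> |\<B>| <o |F| \<and> (\<forall>B\<in>\<B>. emeasure ?p B = 0)"
    let ?\<B> = "(\<lambda>B. \<Union>F \<inter> h -` B) ` \<B>"
    have "|?\<B>| <o |F|" using card_of_image \<B> by (metis ordLeq_ordLess_trans)
    then have "|?\<B>| \<notin> R" using min \<kappa> not_ordLess_ordLeq by blast
    moreover have "?\<B> \<subseteq> Pow I" using F by blast
    moreover have "\<forall>A\<in>?\<B>. emeasure \<pi> A = 0" using \<B> em by blast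
    ultimately have "emeasure \<pi> (\<Union>?\<B>) = 0" unfolding R_def by blast
    moreover have "\<Union>?\<B> = \<Union>F \<inter> h -` (\<Union>\<B>)" by blast
    ultimately have "emeasure \<pi> (\<Union>F \<inter> h -` (\<Union>\<B>)) = 0" by (simp only:)
    moreover have "\<Union>\<B> \<subseteq> F" using \<B> by blast
    ultimately show "emeasure ?p (\<Union>\<B>) = 0" by (simp only: em)
  qed (auto simp: card_of_Card_order card_of_refl)
  moreover have "|F| \<le>o |I|"
    using min[OF S] card_of_image unfolding \<kappa> by (rule ordLeq_transitive)
  ultimately show ?thesis by blast
qed

text \<open>
  Removing the countably many points of positive mass leaves a diffuse measure, which vanishes.
\<close>

lemma countable_support_if_no_real_valued_measurable:
  fixes I :: "'i set"
  assumes "finite_measure \<pi>" and sets: "sets \<pi> = Pow I"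
    and none: "\<And>\<kappa> :: 'i set rel. real_valued_measurable \<kappa> \<Longrightarrow> \<not> \<kappa> \<le>o |I|"
  shows "\<exists>A. countable A \<and> A \<subseteq> I \<and> emeasure \<pi> (I - A) = 0"
proof -
  interpret finite_measure \<pi> by fact
  have sp: "space \<pi> = I" using sets.top[of \<pi>] sets.sets_into_space[of I \<pi>] sets by auto
  define A where "A = {x \<in> I. measure \<pi> {x} \<noteq> 0}"
  have "countable A"
    by (rule countable_subset[OF _ countable_support]) (auto simp: A_def)
  let ?r = "restrict_space \<pi> (I - A)"
  have em: "emeasure ?r B = emeasure \<pi> B" if "B \<subseteq> I - A" for B
    by (rule emeasure_restrict_space) (use that in \<open>auto simp: sets sp\<close>)
  have sets_r: "sets ?r = Pow (I - A)" by (auto simp: sets_restrict_space sets)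
  have "emeasure \<pi> (I - A) = 0"
  proof (rule ccontr)
    assume "emeasure \<pi> (I - A) \<noteq> 0"
    then have "\<exists>\<kappa> :: 'i set rel. real_valued_measurable \<kappa> \<and> \<kappa> \<le>o |I - A|"
      using sets_r
    proof (intro real_valued_measurable_if_diffuse[of ?r])
      show "finite_measure ?r" by (rule finite_measure_restrict_space) (use assms(1) in \<open>auto simp: sets sp\<close>)
      show "emeasure ?r {x} = 0" if "x \<in> I - A" for x
        using that em[of "{x}"] by (simp add: A_def emeasure_eq_measure)
    qed (simp_all add: em)
    moreover have "|I - A| \<le>o |I|" by (rule card_of_mono1) blast
    ultimately show False using none ordLeq_transitive by blast
  qed
  with \<open>countable A\<close> show ?thesis unfolding A_def by blast
qed

section \<open>Maps into spaces of density below every real-valued measurable cardinal\<close>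

text \<open>
  A ball of radius \<open>\<delta>/2\<close> meets at most one of the sets, so the family is locally finite.
\<close>

lemma closed_Union_separated:
  fixes E :: "'i \<Rightarrow> 'b::metric_space set"
  assumes closed: "\<And>i. i \<in> J \<Longrightarrow> closed (E i)" and "\<delta> > 0"
    and sep: "\<And>i j x y. i \<in> J \<Longrightarrow> j \<in> J \<Longrightarrow> i \<noteq> j \<Longrightarrow> x \<in> E i \<Longrightarrow> y \<in> E j \<Longrightarrow> \<delta> \<le> dist x y"
  shows "closed (\<Union>i\<in>J. E i)"
  unfolding closed_def open_contains_ball
proof
  fix x assume x: "x \<in> - (\<Union>i\<in>J. E i)"
  show "\<exists>e>0. ball x e \<subseteq> - (\<Union>i\<in>J. E i)"
  proof (cases "\<exists>i\<in>J. ball x (\<delta>/2) \<inter> E i \<noteq> {}")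
    case False
    then show ?thesis using \<open>\<delta> > 0\<close> by (intro exI[of _ "\<delta>/2"]) auto
  next
    case True
    then obtain i u where i: "i \<in> J" "u \<in> E i" "dist x u < \<delta>/2" by auto
    have only: "j = i" if "j \<in> J" "v \<in> E j" "dist x v < \<delta>/2" for j v
    proof (rule ccontr)
      assume "j \<noteq> i"
      then have "\<delta> \<le> dist u v" using sep i that by blast
      also have "\<dots> \<le> dist x u + dist x v" by (rule dist_triangle3)
      finally show False using i that by simp
    qed
    obtain e where "e > 0" "ball x e \<subseteq> - E i"
      using closed[OF i(1)] x i(1) unfolding closed_def open_contains_ball by blast
    then show ?thesis
      using only \<open>\<delta> > 0\<close> by (intro exI[of _ "min e (\<delta>/2)"]) (fastforce simp: subset_iff)
  qed
qed

lemma ae_covered_by_countably_many_balls: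
  fixes G :: "'a \<Rightarrow> 'b::metric_space" and D :: "'b set"
  assumes "finite_measure M" and G: "G \<in> measurable M borel"
    and dense: "closure D = UNIV" and "r > 0"
    and none: "\<And>\<kappa> :: 'b set rel. real_valued_measurable \<kappa> \<Longrightarrow> \<not> \<kappa> \<le>o |D|"
  shows "\<exists>N \<in> null_sets M. \<exists>C. countable C \<and> (\<forall>x \<in> space M - N. \<exists>c \<in> C. dist c (G x) < r)"
proof -
  interpret finite_measure M by fact
  obtain w :: "'b rel" where w: "well_order_on UNIV w" using well_order_on by blast
  then have wf: "wf (w - Id)" and tot: "\<And>x y. x \<noteq> y \<Longrightarrow> (x, y) \<in> w - Id \<or> (y, x) \<in> w - Id"
    by (auto simp: well_order_on_def linear_order_on_def total_on_def)
  \<comment> \<open>For fixed \<open>s < r\<close> and distinct \<open>y\<close> in \<open>D\<close>, sets at distance at least \<open>r - s\<close> inside the balls of radius \<open>r\<close>.\<close>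
  define E where "E s y = cball y s - (\<Union>z \<in> {z \<in> D. (z, y) \<in> w - Id}. ball z r)" for s y
  have sep': "r - s \<le> dist x x'" if "y \<in> D" "(y, y') \<in> w - Id" "x \<in> E s y" "x' \<in> E s y'" for s x x' y y'
  proof -
    have "r \<le> dist y x'" "dist y x \<le> s" using that by (auto simp: E_def not_less)
    moreover have "dist y x' \<le> dist y x + dist x x'" by (rule dist_triangle)
    ultimately show ?thesis by simp
  qed
  have sep: "r - s \<le> dist x x'"
    if "y \<in> D" "y' \<in> D" "y \<noteq> y'" "x \<in> E s y" "x' \<in> E s y'" for s x x' y y'
    using tot[OF \<open>y \<noteq> y'\<close>] sep'[of y y' x s x'] sep'[of y' y x' s x] that by (auto simp: dist_commute)
  have meas: "G -` (\<Union>y\<in>J. E s y) \<inter> space M \<in> sets M" if "J \<subseteq> D" "s < r" for J s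
  proof -
    have "closed (E s y)" for y unfolding E_def by (intro closed_Diff) auto
    then have "closed (\<Union>y\<in>J. E s y)"
    proof (rule closed_Union_separated)
      show "0 < r - s" using \<open>s < r\<close> by simp
    qed (use that(1) sep in blast)
    then show ?thesis by (intro measurable_sets[OF G]) auto
  qed
  have ae_centres: "\<exists>A. countable A \<and> A \<subseteq> D \<and> G -` (\<Union>y\<in>D - A. E s y) \<inter> space M \<in> null_sets M"
    if "s < r" for s
  proof -
    let ?X = "G -` (\<Union>y\<in>D. E s y) \<inter> space M"
    let ?R = "restrict_space M ?X"
    have X: "?X \<in> sets M" using meas[of D s] that by blast
    \<comment> \<open>\<open>h\<close> sends \<open>x\<close> to the index of the only set that contains \<open>G x\<close>.\<close>
    define h where "h x = (SOME y. y \<in> D \<and> G x \<in> E s y)" for x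
    have h: "h x \<in> D \<and> G x \<in> E s (h x)" if "x \<in> ?X" for x
      unfolding h_def by (rule someI_ex) (use that in blast)
    have h_eq: "h x = y" if "x \<in> ?X" "y \<in> D" "G x \<in> E s y" for x y
      using sep[of "h x" y "G x" s "G x"] h[OF that(1)] that \<open>s < r\<close> by auto
    have spR: "space ?R = ?X" using X by (auto simp: space_restrict_space)
    have pre: "h -` J \<inter> ?X = G -` (\<Union>y\<in>J. E s y) \<inter> space M" if "J \<subseteq> D" for J
    proof (intro equalityI subsetI)
      fix x assume "x \<in> h -` J \<inter> ?X"
      then show "x \<in> G -` (\<Union>y\<in>J. E s y) \<inter> space M" using h[of x] by blast
    next
      fix x assume "x \<in> G -` (\<Union>y\<in>J. E s y) \<inter> space M"
      then obtain y where y: "y \<in> J" "G x \<in> E s y" "x \<in> space M" by blast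
      then have "x \<in> ?X" using that by blast
      then have "h x = y" using h_eq y that by blast
      with y \<open>x \<in> ?X\<close> show "x \<in> h -` J \<inter> ?X" by blast
    qed
    have hm: "h \<in> measurable ?R (count_space D)"
    proof (rule measurableI)
      fix J assume "J \<in> sets (count_space D)"
      then have J: "J \<subseteq> D" by simp
      show "h -` J \<inter> space ?R \<in> sets ?R"
        unfolding spR pre[OF J] using X meas[OF J \<open>s < r\<close>] J
        by (subst sets_restrict_space_iff) auto
    qed (use h spR in auto)
    let ?\<pi> = "distr ?R (count_space D) h"
    have "finite_measure ?\<pi>"
      using hm X assms(1) by (intro finite_measure.finite_measure_distr finite_measure_restrict_space) auto
    then obtain A where A: "countable A" "A \<subseteq> D" "emeasure ?\<pi> (D - A) = 0"
      using countable_support_if_no_real_valued_measurable[of ?\<pi> D] none by auto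
    have "emeasure ?\<pi> (D - A) = emeasure ?R (G -` (\<Union>y\<in>D - A. E s y) \<inter> space M)"
      using hm pre[of "D - A"] by (subst emeasure_distr) (auto simp: spR)
    also have "\<dots> = emeasure M (G -` (\<Union>y\<in>D - A. E s y) \<inter> space M)"
      using X by (intro emeasure_restrict_space) auto
    finally show ?thesis using A meas[of "D - A" s] that by (intro exI[of _ A]) auto
  qed
  let ?s = "\<lambda>n. r - inverse (real (Suc n))"
  have "\<forall>n. \<exists>A. countable A \<and> A \<subseteq> D \<and> G -` (\<Union>y\<in>D - A. E (?s n) y) \<inter> space M \<in> null_sets M"
    using ae_centres[of "?s _"] by simp
  then obtain A where A: "\<And>n. countable (A n)"
    "\<And>n. G -` (\<Union>y\<in>D - A n. E (?s n) y) \<inter> space M \<in> null_sets M"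
    by metis
  let ?N = "\<Union>n. G -` (\<Union>y\<in>D - A n. E (?s n) y) \<inter> space M"
  have "\<exists>c \<in> \<Union>n. A n. dist c (G x) < r" if x: "x \<in> space M - ?N" for x
  proof -
    let ?Q = "{y \<in> D. dist y (G x) < r}"
    have "G x \<in> closure D" using dense by simp
    then obtain y0 where "y0 \<in> ?Q" using \<open>r > 0\<close> by (auto simp: closure_approachable)
    \<comment> \<open>The least centre whose open \<open>r\<close>-ball contains \<open>G x\<close>.\<close>
    with wf obtain y where y: "y \<in> ?Q" "\<And>z. (z, y) \<in> w - Id \<Longrightarrow> z \<notin> ?Q"
      by (rule wfE_min) blast
    from y(1) have "0 < r - dist y (G x)" by simp
    then obtain n where "inverse (real (Suc n)) < r - dist y (G x)" using reals_Archimedean by blast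
    then have "G x \<in> E (?s n) y" using y(2) unfolding E_def by auto
    then have "y \<in> A n" using x y(1) by blast
    with y(1) show ?thesis by blast
  qed
  moreover have "?N \<in> null_sets M" using A(2) by (rule null_sets_UN)
  moreover have "countable (\<Union>n. A n)" using A(1) by simp
  ultimately show ?thesis by blast
qed

lemma essentially_separable_range_if_dens_below_measurable:
  fixes G :: "'a \<Rightarrow> 'b::metric_space"
  assumes "finite_measure M" "G \<in> measurable M borel" and below: "dens_below_measurable TYPE('b)"
  shows "essentially_separable_range M G"
proof (rule essentially_separable_range_if_countable_nets)
  fix e :: real assume "e > 0"
  obtain D :: "'b set" where D: "closure D = UNIV" "dens = |D|" using dens_attained by blast
  show "\<exists>N \<in> null_sets M. \<exists>C. countable C \<and> (\<forall>x \<in> space M - N. \<exists>c \<in> C. dist c (G x) < e)"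
  proof (rule ae_covered_by_countably_many_balls[OF assms(1,2) D(1) \<open>e > 0\<close>])
    fix \<kappa> :: "'b set rel" assume "real_valued_measurable \<kappa>"
    from dens_below_measurable_any_type[OF below this]
    show "\<not> \<kappa> \<le>o |D|" unfolding D(2) by (rule not_ordLess_ordLeq)
  qed
qed

lemma sigma_finite_imp_equivalent_finite_measure:
  assumes "sigma_finite_measure M"
  obtains M' where "finite_measure M'" "sets M' = sets M" "null_sets M' = null_sets M"
proof -
  interpret sigma_finite_measure M by fact
  obtain f :: "'a \<Rightarrow> real" where f [measurable]: "f \<in> borel_measurable M" and pos: "\<And>x. f x > 0"
    and int: "integrable M f"
    by (rule obtain_positive_integrable_function) blast
  let ?M = "density M (\<lambda>x. ennreal (f x))"
  have "emeasure ?M (space ?M) = (\<integral>\<^sup>+x. ennreal (f x) \<partial>M)"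
    by (simp add: emeasure_density cong: nn_integral_cong)
  also have "\<dots> < \<infinity>"
    using int pos by (simp add: integrable_iff_bounded less_imp_le)
  finally have "finite_measure ?M" by (intro finite_measureI) auto
  moreover have "A \<in> null_sets ?M \<longleftrightarrow> A \<in> null_sets M" for A
  proof -
    have "ennreal (f x) \<noteq> 0" for x using pos[of x] by (simp add: ennreal_eq_0_iff)
    then have "A \<in> null_sets ?M \<longleftrightarrow> A \<in> sets M \<and> (AE x in M. x \<notin> A)"
      by (subst null_sets_density_iff) auto
    then show ?thesis using AE_iff_null_sets by blast
  qed
  ultimately show thesis using that[of ?M] by auto
qed

section \<open>No real-valued measurable cardinal up to the continuum under CH\<close>

text \<open>
  Well-order the index set \<open>I\<close> so that all proper initial segments \<open>below x\<close> are countable, and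
  enumerate each of them. The entry \<open>ulam n y\<close> of Ulam's matrix consists of the \<open>x\<close> above \<open>y\<close> for
  which \<open>y\<close> has number \<open>n\<close> below \<open>x\<close>. For fixed \<open>y\<close> the entries cover all but countably many points,
  so one of them has positive measure. For fixed \<open>n\<close> the entries are disjoint, so only countably
  many have positive measure. Hence \<open>I\<close> would be countable. The additivity of null sets beyond
  countable families plays no role.
\<close>

lemma not_real_valued_measurable_if_le_continuum:
  fixes \<kappa> :: "'k rel"
  assumes CH: "continuum_hypothesis" and le: "\<kappa> \<le>o |UNIV :: real set|"
  shows "\<not> real_valued_measurable \<kappa>"
proof
  assume "real_valued_measurable \<kappa>"
  then obtain I :: "'k set" and \<pi> where I: "|I| =o \<kappa>" and ps: "prob_space \<pi>"
    and sets: "sets \<pi> = Pow I" and pt: "\<forall>x\<in>I. emeasure \<pi> {x} = 0"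
    unfolding real_valued_measurable_def by (elim conjE exE) (rule that)
  interpret prob_space \<pi> by fact
  have sp: "space \<pi> = I" using sets.top[of \<pi>] sets.sets_into_space[of I \<pi>] sets by auto
  have null: "emeasure \<pi> A = 0" if "countable A" "A \<subseteq> I" for A
  proof -
    have "{x} \<in> null_sets \<pi>" if "x \<in> A" for x
      using pt \<open>A \<subseteq> I\<close> that by (auto simp: null_sets_def sets)
    then have "(\<Union>x\<in>A. {x}) \<in> null_sets \<pi>" using \<open>countable A\<close> by (intro null_sets_UN') auto
    then show ?thesis by auto
  qed
  have unctble: "\<not> countable I" using null[of I] emeasure_space_1 sp by auto
  define below where "below x = underS ( |I| ) x" for x
  have below: "countable (below x)" "below x \<subseteq> I" if "x \<in> I" for x
  proof -
    have "|below x| <o |I|"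
      unfolding below_def using that by (intro card_of_underS card_of_Card_order) (simp add: Field_card_of)
    moreover have "|I| \<le>o |UNIV :: real set|" using I le by (rule ordIso_ordLeq_trans)
    ultimately have "|below x| <o |UNIV :: real set|" by (rule ordLess_ordLeq_trans)
    then show "countable (below x)" by (rule countable_if_card_less_continuum[OF CH])
    show "below x \<subseteq> I" by (auto simp: below_def underS_def Field_card_of dest: FieldI1)
  qed
  have compare: "x = y \<or> x \<in> below y \<or> y \<in> below x" if "x \<in> I" "y \<in> I" for x y
    using card_of_well_order_on[of I] that
    by (auto simp: below_def underS_def well_order_on_def linear_order_on_def total_on_def)
  define f where "f x = to_nat_on (below x)" for x
  define ulam where "ulam n y = {x \<in> I. y \<in> below x \<and> f x y = n}" for n y
  have "\<exists>n. measure \<pi> (ulam n y) \<noteq> 0" if y: "y \<in> I" for y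
  proof (rule ccontr)
    assume "\<not> ?thesis"
    then have "ulam n y \<in> null_sets \<pi>" for n
      by (auto simp: null_sets_def sets emeasure_eq_measure ulam_def)
    then have "(\<Union>n. ulam n y) \<in> null_sets \<pi>" by (rule null_sets_UN)
    moreover have "insert y (below y) \<in> null_sets \<pi>"
      using null[of "insert y (below y)"] below[OF y] y by (auto simp: null_sets_def sets)
    ultimately have "(\<Union>n. ulam n y) \<union> insert y (below y) \<in> null_sets \<pi>" by (rule null_sets.Un)
    moreover have "(\<Union>n. ulam n y) \<union> insert y (below y) = I"
    proof (intro equalityI subsetI)
      fix x assume "x \<in> I"
      then show "x \<in> (\<Union>n. ulam n y) \<union> insert y (below y)"
        using compare[OF \<open>x \<in> I\<close> y] by (auto simp: ulam_def)
    qed (use below(2)[OF y] y in \<open>auto simp: ulam_def\<close>)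
    ultimately show False using emeasure_space_1 sp by auto
  qed
  then obtain n where n: "\<And>y. y \<in> I \<Longrightarrow> measure \<pi> (ulam (n y) y) \<noteq> 0" by metis
  have row: "countable {y \<in> I. measure \<pi> (ulam k y) \<noteq> 0}" for k
  proof -
    \<comment> \<open>On \<open>ulam k y\<close> the map \<open>h\<close> is constantly \<open>y\<close>, so if that set is not null, \<open>y\<close> is a point mass of the distribution of \<open>h\<close>.\<close>
    define h where "h x = from_nat_into (below x) k" for x
    let ?p = "distr \<pi> (count_space UNIV) h"
    have h: "h \<in> measurable \<pi> (count_space UNIV)" by (rule measurableI) (auto simp: sp sets)
    then interpret p: prob_space ?p by (rule prob_space_distr)
    have "measure ?p {y} \<noteq> 0" if "measure \<pi> (ulam k y) \<noteq> 0" "y \<in> I" for y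
    proof -
      have "ulam k y \<subseteq> h -` {y} \<inter> I"
        using below(1) unfolding ulam_def h_def f_def by auto
      then have "measure \<pi> (ulam k y) \<le> measure \<pi> (h -` {y} \<inter> I)"
        by (intro finite_measure_mono) (auto simp: sets)
      then show ?thesis
        using that(1) h zero_less_measure_iff[of \<pi> "ulam k y"] by (simp add: measure_distr sp)
    qed
    then show ?thesis by (intro countable_subset[OF _ p.countable_support]) auto
  qed
  have "I \<subseteq> (\<Union>k. {y \<in> I. measure \<pi> (ulam k y) \<noteq> 0})" using n by blast
  moreover have "countable (\<Union>k. {y \<in> I. measure \<pi> (ulam k y) \<noteq> 0})"
    using row by simp
  ultimately show False using unctble countable_subset by blast
qed

lemma dens_below_measurable_if_le_continuum:
  assumes CH: "continuum_hypothesis" and le: "(dens :: 'b::metric_space rel) \<le>o |UNIV :: real set|"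
  shows "dens_below_measurable TYPE('b)"
  unfolding dens_below_measurable_def
proof (intro allI impI)
  fix \<kappa> :: "'b rel" assume \<kappa>: "real_valued_measurable \<kappa>"
  then have wo: "Well_order \<kappa>" by (simp add: real_valued_measurable_def card_order_on_well_order_on)
  have "\<not> \<kappa> \<le>o (dens :: 'b rel)"
    using not_real_valued_measurable_if_le_continuum[OF CH] \<kappa> le ordLeq_transitive by blast
  moreover have "Well_order (dens :: 'b rel)" using dens_attained card_of_Well_order by metis
  ultimately show "(dens :: 'b rel) <o \<kappa>" using wo not_ordLeq_iff_ordLess by blast
qed

section \<open>Strong measurability of Borel maps\<close>

theorem theorem1p1:
  fixes M :: "'a measure" and G :: "'a \<Rightarrow> 'b::metric_space"
  assumes "G \<in> measurable M borel"
  shows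
    "(strongly_measurable M G \<longleftrightarrow> essentially_separable_range M G)
   \<and> (continuum_hypothesis \<longrightarrow>
        (countably_generated M \<longrightarrow> strongly_measurable M G)
      \<and> (\<forall>T :: 'a topology.
           topspace T = space M \<and> second_countable T
             \<and> sets M = sigma_sets (topspace T) {U. openin T U} \<longrightarrow>
           countably_generated M \<and> strongly_measurable M G))
   \<and> (finite_measure M \<or> sigma_finite_measure M \<longrightarrow>
        (dens_below_measurable TYPE('b) \<longrightarrow> strongly_measurable M G)
      \<and> (continuum_hypothesis \<and> (dens :: 'b rel) \<le>o |UNIV :: real set| \<longrightarrow>
           dens_below_measurable TYPE('b) \<and> strongly_measurable M G)
      \<and> ((\<nexists>\<kappa> :: 'b rel. real_valued_measurable \<kappa>) \<longrightarrow>
           dens_below_measurable TYPE('b) \<and> strongly_measurable M G))"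
proof -
  have iff: "strongly_measurable M G \<longleftrightarrow> essentially_separable_range M G"
    using strongly_measurable_imp_essentially_separable_range
      essentially_separable_range_imp_strongly_measurable[OF assms] by blast
  have cg: "strongly_measurable M G" if "continuum_hypothesis" "countably_generated M"
    using countably_generated_imp_essentially_separable_range[OF assms that] iff by blast
  have cg_top: "countably_generated M"
    if "topspace T = space M \<and> second_countable T \<and> sets M = sigma_sets (topspace T) {U. openin T U}"
    for T :: "'a topology"
    using countably_generated_second_countable[of T M] that by blast
  have sf: "strongly_measurable M G"
    if fin: "finite_measure M \<or> sigma_finite_measure M" and below: "dens_below_measurable TYPE('b)"
  proof -
    from fin have "sigma_finite_measure M" using finite_measure.axioms(1) by blast
    then obtain M' where M': "finite_measure M'" "sets M' = sets M" "null_sets M' = null_sets M"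
      by (rule sigma_finite_imp_equivalent_finite_measure)
    have "G \<in> measurable M' borel" using assms M'(2) by (simp cong: measurable_cong_sets)
    then have "essentially_separable_range M' G"
      using M'(1) below by (intro essentially_separable_range_if_dens_below_measurable)
    then have "essentially_separable_range M G"
      unfolding essentially_separable_range_def M'(3) sets_eq_imp_space_eq[OF M'(2)] .
    then show ?thesis using iff by blast
  qed
  have dens_cont: "dens_below_measurable TYPE('b)"
    if "continuum_hypothesis \<and> (dens :: 'b rel) \<le>o |UNIV :: real set|"
    using dens_below_measurable_if_le_continuum that by blast
  have dens_none: "dens_below_measurable TYPE('b)" if "\<nexists>\<kappa> :: 'b rel. real_valued_measurable \<kappa>"
    using that unfolding dens_below_measurable_def by blast
  show ?thesis
  proof (intro conjI impI allI)
    show "countably_generated M" "strongly_measurable M G"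
      if "continuum_hypothesis"
        "topspace T = space M \<and> second_countable T \<and> sets M = sigma_sets (topspace T) {U. openin T U}"
      for T :: "'a topology"
      using cg cg_top that by blast+
  qed (use iff cg sf dens_cont dens_none in blast)+
qed

end
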